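(* Let $G_1$ be a bounded subdomain of a domain $G_2\subsetneq\mathbb{R}^n$, and let $$c=1+\frac{2\operatorname{dist}(G_1,\partial G_2)}{\operatorname{diam}(G_1)}.$$ Then for all $x,y\in G_1$, $$j_{G_1}(x,y)\ge c\,j_{G_2}(x,y)\quad\text{and}\quad k_{G_1}(x,y)\ge c\,k_{G_2}(x,y).$$
   Context: $\operatorname{dist}$ and $\operatorname{diam}$ denote Euclidean distance between sets and Euclidean diameter. For a domain (open connected nonempty set) $G\subsetneq\mathbb{R}^n$, $\delta_G(x)$ is the Euclidean distance from $x\in G$ to $\partial G$. For $x,y\in G$, the distance ratio metric is $$j_G(x,y)=\log\left(1+\frac{|x-y|}{\min\{\delta_G(x),\delta_G(y)\}}\right),$$ and the quasihyperbolic metric is $$k_G(x,y)=\inf_{\gamma}\int_\gamma\frac{|dz|}{\delta_G(z)},$$ where the infimum is over all rectifiable paths $\gamma$ in $G$ joining $x$ and $y$. A subdomain of $G_2$ is a domain contained in $G_2$. *)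

theory Defs
  imports "HOL-Analysis.Analysis"
begin

definition domain_set :: "'a::euclidean_space set \<Rightarrow> bool" where
  "domain_set G \<longleftrightarrow> open G \<and> connected G \<and> G \<noteq> {}"

definition bdist :: "'a::euclidean_space set \<Rightarrow> 'a \<Rightarrow> real" where
  "bdist G x = infdist x (frontier G)"

definition distance_ratio :: "'a::euclidean_space set \<Rightarrow> 'a \<Rightarrow> 'a \<Rightarrow> real" where
  "distance_ratio G x y = ln (1 + dist x y / min (bdist G x) (bdist G y))"

definition polygonal_lengths :: "(real \<Rightarrow> 'a::euclidean_space) \<Rightarrow> real \<Rightarrow> real \<Rightarrow> real set" where
  "polygonal_lengths g a b =
     {(\<Sum>i<n. dist (g (t i)) (g (t (Suc i)))) | (n::nat) (t::nat \<Rightarrow> real).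
        t 0 = a \<and> t n = b \<and> (\<forall>i<n. t i \<le> t (Suc i))}"

text \<open>Paths are parametrised by the unit interval, as in the library.\<close>

definition rectifiable_path :: "(real \<Rightarrow> 'a::euclidean_space) \<Rightarrow> bool" where
  "rectifiable_path g \<longleftrightarrow> path g \<and> bdd_above (polygonal_lengths g 0 1)"

definition curve_length :: "(real \<Rightarrow> 'a::euclidean_space) \<Rightarrow> real \<Rightarrow> real \<Rightarrow> real" where
  "curve_length g a b = Sup (polygonal_lengths g a b)"

text \<open>Parametrisation by arc length. For a rectifiable path, the length of the part over \<open>[0,t]\<close>
  is a continuous function of \<open>t\<close>, so a suitable \<open>t\<close> exists for every \<open>s\<close> between \<open>0\<close> and the
  total length; two such \<open>t\<close> bound an interval on which \<open>g\<close> is constant, so the value does not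
  depend on the choice.\<close>

definition arclength_param :: "(real \<Rightarrow> 'a::euclidean_space) \<Rightarrow> real \<Rightarrow> 'a" where
  "arclength_param g s = g (SOME t. t \<in> {0..1} \<and> curve_length g 0 t = s)"

definition arclength_integral :: "(real \<Rightarrow> 'a::euclidean_space) \<Rightarrow> ('a \<Rightarrow> real) \<Rightarrow> real" where
  "arclength_integral g \<rho> =
     integral {0..curve_length g 0 1} (\<lambda>s. \<rho> (arclength_param g s))"

definition quasihyperbolic :: "'a::euclidean_space set \<Rightarrow> 'a \<Rightarrow> 'a \<Rightarrow> real" where
  "quasihyperbolic G x y =
     (INF g \<in> {g. rectifiable_path g \<and> path_image g \<subseteq> G \<and> pathstart g = x \<and> pathfinish g = y}.
        arclength_integral g (\<lambda>z. 1 / bdist G z))"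

end

theory Submission
  imports Defs
begin

text \<open>
  Write \<open>\<delta>\<^sub>1, \<delta>\<^sub>2\<close> for the boundary distances, \<open>d\<close> for the distance from \<open>G\<^sub>1\<close> to the boundary of
  \<open>G\<^sub>2\<close> and \<open>D\<close> for the diameter of \<open>G\<^sub>1\<close>. A segment from \<open>x \<in> G\<^sub>1\<close> to a nearest point of the boundary
  of \<open>G\<^sub>2\<close> crosses the boundary of \<open>G\<^sub>1\<close>, so \<open>\<delta>\<^sub>2 x \<ge> \<delta>\<^sub>1 x + d\<close>. Extending the segment from \<open>x\<close> to \<open>y\<close>
  beyond both ends gives \<open>\<bar>x - y\<bar> + \<delta>\<^sub>1 x + \<delta>\<^sub>1 y \<le> D\<close>.

  For \<open>x = y\<close> the two facts give \<open>\<delta>\<^sub>2 \<ge> c \<delta>\<^sub>1\<close> pointwise, and integration along paths gives the claim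
  on \<open>k\<close>. For \<open>j\<close> the pointwise bound is not enough (Bernoulli's inequality goes the wrong way);
  there, with \<open>h = \<bar>x - y\<bar> / 2\<close> and \<open>a = h + min (\<delta>\<^sub>1 x) (\<delta>\<^sub>1 y) \<le> D / 2\<close>, the claim reduces to the
  monotonicity of \<open>a \<mapsto> a ln ((a + h) / (a - h))\<close>.
\<close>

section \<open>Boundary distances\<close>

text \<open>The open ball is connected, meets \<open>G\<close> and misses its frontier, so it lies
  in \<open>G\<close>. Taking closures lets points at distance exactly \<open>bdist G x\<close> be
  used.\<close>

lemma cball_bdist_subset_closure:
  fixes G :: "'a::euclidean_space set"
  assumes "x \<in> G"
  shows "cball x (bdist G x) \<subseteq> closure G"
proof (cases "bdist G x > 0")
  case True
  have "ball x (bdist G x) \<inter> frontier G = {}"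
    using infdist_le[of _ "frontier G" x] by (fastforce simp: bdist_def)
  moreover have "ball x (bdist G x) \<inter> G \<noteq> {}"
    using assms True centre_in_ball by blast
  ultimately have "ball x (bdist G x) \<subseteq> G"
    using connected_Int_frontier[OF connected_ball] by blast
  then show ?thesis
    using closure_mono closure_ball[OF True, of x] by metis
next
  case False
  then have "bdist G x = 0"
    using infdist_nonneg[of x "frontier G"] by (simp add: bdist_def)
  then show ?thesis
    using assms closure_subset by auto
qed

lemma dist_add_bdist_le_diameter:
  fixes G :: "'a::euclidean_space set"
  assumes "bounded G" "x \<in> G" "y \<in> G"
  shows "dist x y + bdist G x + bdist G y \<le> diameter G"
proof -
  \<comment> \<open>For \<open>x = y\<close> any unit vector serves as direction; this case yields
    \<open>2 * bdist G x \<le> diameter G\<close>.\<close>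
  obtain u where u: "norm u = 1" "y - x = dist x y *\<^sub>R u"
  proof (cases "x = y")
    case True
    obtain b :: 'a where "b \<in> Basis" using nonempty_Basis by blast
    then show ?thesis using that[of b] True by simp
  next
    case False
    then show ?thesis
      using that[of "(y - x) /\<^sub>R dist x y"] by (simp add: dist_norm norm_minus_commute)
  qed
  have nn: "bdist G x \<ge> 0" "bdist G y \<ge> 0"
    by (simp_all add: bdist_def infdist_nonneg)
  have "x - bdist G x *\<^sub>R u \<in> closure G" "y + bdist G y *\<^sub>R u \<in> closure G"
    using cball_bdist_subset_closure[OF assms(2)] cball_bdist_subset_closure[OF assms(3)] nn u(1)
    by (auto simp: subset_iff dist_norm)
  then have "dist (y + bdist G y *\<^sub>R u) (x - bdist G x *\<^sub>R u) \<le> diameter G"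
    using diameter_bounded_bound diameter_closure assms(1) bounded_closure by metis
  moreover have "y + bdist G y *\<^sub>R u - (x - bdist G x *\<^sub>R u)
      = (dist x y + bdist G x + bdist G y) *\<^sub>R u"
    using u(2) by (simp add: algebra_simps)
  ultimately show ?thesis
    using nn u(1) by (simp add: dist_norm)
qed

lemma bdist_add_setdist_le:
  fixes G H :: "'a::euclidean_space set"
  assumes "open H" "G \<subseteq> H" "H \<noteq> UNIV" "x \<in> G"
  shows "bdist G x + setdist G (frontier H) \<le> bdist H x"
proof -
  have "frontier H \<noteq> {}"
    using assms frontier_eq_empty by blast
  then obtain z where z: "z \<in> frontier H" "bdist H x = dist x z"
    using infdist_attains_inf[OF frontier_closed] by (metis bdist_def)
  then have "z \<notin> G"
    using assms frontier_disjoint_eq by blast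
  then obtain w where w: "w \<in> closed_segment x z" "w \<in> frontier G"
    using connected_Int_frontier[of "closed_segment x z" G] assms(4) by auto
  have "dist x z = dist x w + dist w z"
    using w(1) between between_mem_segment by blast
  moreover have "bdist G x \<le> dist x w"
    using w(2) by (simp add: bdist_def infdist_le)
  \<comment> \<open>The crossing point \<open>w\<close> is only known to lie in the closure of
    \<open>G\<close>, and passing to the closure leaves \<open>setdist\<close> unchanged.\<close>
  moreover have "setdist G (frontier H) \<le> dist w z"
    using w(2) z(1) setdist_le_dist[of w "closure G" z "frontier H"]
    by (simp add: frontier_def)
  ultimately show ?thesis using z(2) by linarith
qed

text \<open>A nonempty frontier is essential here, since \<open>infdist\<close> to the empty set is
  0 by convention.\<close>

lemma bdist_pos:
  fixes G :: "'a::euclidean_space set"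
  assumes "open G" "G \<noteq> UNIV" "x \<in> G"
  shows "bdist G x > 0"
proof -
  have "frontier G \<noteq> {}" "x \<notin> frontier G"
    using assms frontier_eq_empty frontier_disjoint_eq by blast+
  then show ?thesis
    unfolding bdist_def by (intro infdist_pos_not_in_closed) auto
qed

section \<open>The distance ratio metric\<close>

text \<open>With \<open>s = ln r\<close> this is \<open>s \<le> sinh s\<close>.\<close>

lemma two_mult_ln_le:
  fixes r :: real
  assumes "r \<ge> 1"
  shows "2 * ln r \<le> r - 1 / r"
  using real_le_x_sinh[of "ln r"] assms by (simp add: field_simps)

text \<open>With \<open>r = (x + h) / (x - h)\<close> the derivative at \<open>x\<close> is
  \<open>ln r - (r - 1 / r) / 2\<close>, which is nonpositive by
  \<open>two_mult_ln_le\<close>.\<close>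

lemma mult_ln_quotient_antimono:
  fixes a b h :: real
  assumes "0 < h" "h < a" "a \<le> b"
  shows "b * ln ((b + h) / (b - h)) \<le> a * ln ((a + h) / (a - h))"
proof (rule DERIV_nonpos_imp_nonincreasing[OF assms(3)])
  fix x assume "a \<le> x" "x \<le> b"
  then have x: "x - h > 0" "x + h > 0" "x > 0" using assms by auto
  let ?r = "(x + h) / (x - h)"
  let ?y = "ln ?r - 2 * h * x / ((x + h) * (x - h))"
  have "((\<lambda>a. a * ln ((a + h) / (a - h))) has_real_derivative ?y) (at x)"
    using x by (auto intro!: derivative_eq_intros simp: divide_simps)
  moreover have "2 * ln ?r \<le> ?r - 1 / ?r"
    using x assms by (intro two_mult_ln_le) (simp add: field_simps)
  moreover have "?r - 1 / ?r = 2 * (2 * h * x / ((x + h) * (x - h)))"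
    using x by (simp add: divide_simps) (simp add: algebra_simps)
  ultimately show "\<exists>y. ((\<lambda>a. a * ln ((a + h) / (a - h))) has_real_derivative y) (at x) \<and> y \<le> 0"
    by (intro exI[of _ ?y]) linarith
qed

text \<open>The claim on j in real numbers: \<open>t\<close> is the distance of the two points,
  \<open>m\<close> and \<open>M\<close> are the smaller boundary distances in the inner and outer
  domain, \<open>d\<close> is the gap and \<open>D\<close> the diameter.\<close>

lemma ln_ratio_le:
  fixes t m d D M :: real
  assumes "t \<ge> 0" "m > 0" "d \<ge> 0" "t + 2 * m \<le> D" "m + d \<le> M"
  shows "(1 + 2 * d / D) * ln (1 + t / M) \<le> ln (1 + t / m)"
proof (cases "t = 0")
  case False
  then have t: "t > 0" using assms by simp
  \<comment> \<open>With \<open>h = t / 2\<close>, the quotient at \<open>a\<close> is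
    \<open>1 + t / m\<close>, and moving from \<open>a\<close> to \<open>a + d\<close> replaces
    \<open>m\<close> by \<open>m + d\<close>. Since \<open>2 * a \<le> D\<close>, the constant is at
    most \<open>(a + d) / a\<close>.\<close>
  define a where "a = m + t / 2"
  have a: "a > 0" "2 * a \<le> D" using assms t by (auto simp: a_def)
  have "(a + d) * ln ((a + d + t / 2) / (a + d - t / 2)) \<le> a * ln ((a + t / 2) / (a - t / 2))"
    using assms t by (intro mult_ln_quotient_antimono) (auto simp: a_def)
  also have "(a + d + t / 2) / (a + d - t / 2) = 1 + t / (m + d)"
    using assms by (simp add: a_def field_simps)
  also have "(a + t / 2) / (a - t / 2) = 1 + t / m"
    using assms by (simp add: a_def field_simps)
  finally have *: "(a + d) * ln (1 + t / (m + d)) \<le> a * ln (1 + t / m)" .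
  have "ln (1 + t / M) \<le> ln (1 + t / (m + d))"
    using assms t by (auto intro!: ln_mono divide_left_mono add_pos_nonneg)
  moreover have "2 * d / D \<le> d / a"
    using a assms mult_right_mono[OF a(2) assms(3)] by (simp add: field_simps)
  ultimately have "(1 + 2 * d / D) * ln (1 + t / M) \<le> (1 + d / a) * ln (1 + t / (m + d))"
    using assms a by (intro mult_mono) auto
  also have "\<dots> \<le> ln (1 + t / m)"
    using * a by (simp add: field_simps)
  finally show ?thesis .
qed auto

section \<open>Lengths of paths\<close>

lemma partition_mono:
  fixes t :: "nat \<Rightarrow> real"
  assumes "\<forall>i<n. t i \<le> t (Suc i)" "i \<le> j" "j \<le> n"
  shows "t i \<le> t j"
  using assms(2,3)
proof (induction j rule: dec_induct)
  case (step k)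
  then show ?case using assms(1) by (meson Suc_le_lessD less_imp_le order_trans)
qed simp

lemma polygonal_lengths_concat:
  assumes "p \<in> polygonal_lengths g a u" "q \<in> polygonal_lengths g u b"
  shows "p + q \<in> polygonal_lengths g a b"
proof -
  obtain n t where t: "p = (\<Sum>i<n. dist (g (t i)) (g (t (Suc i))))" "t 0 = a" "t n = u"
      "\<forall>i<n. t i \<le> t (Suc i)"
    using assms(1) by (auto simp: polygonal_lengths_def)
  obtain m r where r: "q = (\<Sum>i<m. dist (g (r i)) (g (r (Suc i))))" "r 0 = u" "r m = b"
      "\<forall>i<m. r i \<le> r (Suc i)"
    using assms(2) by (auto simp: polygonal_lengths_def)
  define s where "s i = (if i \<le> n then t i else r (i - n))" for i
  have s_left: "s i = t i" if "i \<le> n" for i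
    using that by (simp add: s_def)
  \<comment> \<open>At \<open>i = 0\<close> the definition selects \<open>t n\<close>, which agrees
    with \<open>r 0\<close> because both equal \<open>u\<close>.\<close>
  have s_right: "s (n + i) = r i" for i
    using t(3) r(2) by (cases i) (auto simp: s_def)
  have "(\<Sum>i<n + m. dist (g (s i)) (g (s (Suc i)))) = p + q"
  proof -
    have "(\<Sum>i<n + k. dist (g (s i)) (g (s (Suc i))))
        = p + (\<Sum>i<k. dist (g (r i)) (g (r (Suc i))))" for k
    proof (induction k)
      case 0
      show ?case unfolding t(1) by (auto intro!: sum.cong simp: s_left)
    next
      case (Suc k)
      then show ?case using s_right[of k] s_right[of "Suc k"] by simp
    qed
    then show ?thesis using r(1) by simp
  qed
  moreover have "s 0 = a" "s (n + m) = b"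
    using s_left[of 0] s_right[of m] t r by auto
  moreover have "s i \<le> s (Suc i)" if "i < n + m" for i
  proof (cases "i < n")
    case True
    then show ?thesis using s_left t(4) by simp
  next
    case False
    then obtain k where "i = n + k" using le_Suc_ex not_less by blast
    then show ?thesis using that r(4) s_right[of k] s_right[of "Suc k"] by simp
  qed
  ultimately show ?thesis
    unfolding polygonal_lengths_def mem_Collect_eq
    by (intro exI[of _ "n + m"] exI[of _ s]) simp
qed

lemma dist_in_polygonal_lengths:
  assumes "a \<le> b"
  shows "dist (g a) (g b) \<in> polygonal_lengths g a b"
  unfolding polygonal_lengths_def mem_Collect_eq
  by (rule exI[of _ 1], rule exI[of _ "\<lambda>i. if i = 0 then a else b"]) (use assms in auto)

lemma polygonal_lengths_nonneg: "p \<in> polygonal_lengths g a b \<Longrightarrow> p \<ge> 0"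
  by (auto simp: polygonal_lengths_def intro: sum_nonneg)

text \<open>Adding the chords over \<open>[a,u]\<close> and \<open>[v,b]\<close> turns a polygonal
  sum over \<open>[u,v]\<close> into one over \<open>[a,b]\<close> that is no smaller.\<close>

lemma bdd_above_polygonal_lengths_mono:
  assumes "bdd_above (polygonal_lengths g a b)" "a \<le> u" "u \<le> v" "v \<le> b"
  shows "bdd_above (polygonal_lengths g u v)"
proof -
  obtain B where B: "\<And>p. p \<in> polygonal_lengths g a b \<Longrightarrow> p \<le> B"
    using assms(1) by (auto simp: bdd_above_def)
  have "p \<le> B" if "p \<in> polygonal_lengths g u v" for p
  proof -
    have "dist (g a) (g u) + p + dist (g v) (g b) \<in> polygonal_lengths g a b"
      using that dist_in_polygonal_lengths assms polygonal_lengths_concat by metis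
    then show ?thesis using B by (smt (verit) zero_le_dist)
  qed
  then show ?thesis by (auto simp: bdd_above_def)
qed

lemma dist_le_curve_length:
  assumes "bdd_above (polygonal_lengths g a b)" "a \<le> b"
  shows "dist (g a) (g b) \<le> curve_length g a b"
  unfolding curve_length_def by (intro cSup_upper dist_in_polygonal_lengths assms)

text \<open>Sums over adjacent intervals concatenate; the suprema are then taken one at a time,
  first over \<open>p\<close> with \<open>q\<close> fixed.\<close>

lemma curve_length_superadditive:
  assumes "bdd_above (polygonal_lengths g a b)" "a \<le> u" "u \<le> b"
  shows "curve_length g a u + curve_length g u b \<le> curve_length g a b"
proof -
  have ne: "polygonal_lengths g a u \<noteq> {}" "polygonal_lengths g u b \<noteq> {}"
    using dist_in_polygonal_lengths assms by blast+
  have sum_le: "p + q \<le> curve_length g a b"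
    if "p \<in> polygonal_lengths g a u" "q \<in> polygonal_lengths g u b" for p q
    unfolding curve_length_def
    using that by (intro cSup_upper polygonal_lengths_concat assms)
  have "curve_length g a u \<le> curve_length g a b - q" if "q \<in> polygonal_lengths g u b" for q
    unfolding curve_length_def[of g a u]
    by (rule cSup_least[OF ne(1)]) (use sum_le that in fastforce)
  then have "curve_length g u b \<le> curve_length g a b - curve_length g a u"
    unfolding curve_length_def[of g u b]
    by (intro cSup_least[OF ne(2)]) fastforce
  then show ?thesis by simp
qed

lemma dist_le_curve_length_diff:
  assumes "rectifiable_path g" "0 \<le> u" "u \<le> v" "v \<le> 1"
  shows "dist (g u) (g v) \<le> curve_length g 0 v - curve_length g 0 u"
proof -
  have bdd: "bdd_above (polygonal_lengths g 0 1)"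
    using assms by (simp add: rectifiable_path_def)
  have "dist (g u) (g v) \<le> curve_length g u v"
    using assms by (intro dist_le_curve_length bdd_above_polygonal_lengths_mono[OF bdd]) auto
  moreover have "curve_length g 0 u + curve_length g u v \<le> curve_length g 0 v"
    using assms by (intro curve_length_superadditive bdd_above_polygonal_lengths_mono[OF bdd]) auto
  ultimately show ?thesis by simp
qed

lemma curve_length_refl: "curve_length g a a = 0"
proof -
  have "p = 0" if p: "p \<in> polygonal_lengths g a a" for p
  proof -
    obtain n t where t: "p = (\<Sum>i<n. dist (g (t i)) (g (t (Suc i))))" "t 0 = a" "t n = a"
        "\<forall>i<n. t i \<le> t (Suc i)"
      using p unfolding polygonal_lengths_def by blast
    have "t i = a" if "i \<le> n" for i
      using partition_mono[of n t 0 i] partition_mono[of n t i n] t that by simp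
    then show ?thesis using t(1) by simp
  qed
  then have "polygonal_lengths g a a = {0}"
    using dist_in_polygonal_lengths[of a a g] by auto
  then show ?thesis by (simp add: curve_length_def)
qed

text \<open>Clamping one nearly optimal partition of \<open>[0,1]\<close> to \<open>[0,u]\<close> and to \<open>[u,1]\<close> approximates the
  length function uniformly from below by a function that is continuous in \<open>u\<close>.\<close>

lemma curve_length_approx:
  assumes "rectifiable_path g" "e > 0"
  obtains F where "continuous_on {0..1} F"
    "\<And>u. u \<in> {0..1} \<Longrightarrow> \<bar>F u - curve_length g 0 u\<bar> < e"
proof -
  have bdd: "bdd_above (polygonal_lengths g 0 1)" and cont: "continuous_on {0..1} g"
    using assms by (auto simp: rectifiable_path_def path_def)
  have "curve_length g 0 1 - e < Sup (polygonal_lengths g 0 1)"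
    using assms by (simp add: curve_length_def)
  then obtain p where p: "p \<in> polygonal_lengths g 0 1" "curve_length g 0 1 - e < p"
    using less_cSup_iff[OF _ bdd] dist_in_polygonal_lengths[of 0 1 g] by auto
  obtain n t where t: "p = (\<Sum>i<n. dist (g (t i)) (g (t (Suc i))))" "t 0 = 0" "t n = 1"
      "\<forall>i<n. t i \<le> t (Suc i)"
    using p by (auto simp: polygonal_lengths_def)
  have t0: "t i \<ge> 0" if "i \<le> n" for i
    using partition_mono[of n t 0 i] t that by simp
  define F where "F u = (\<Sum>i<n. dist (g (min (t i) u)) (g (min (t (Suc i)) u)))" for u
  have F: "F u \<in> polygonal_lengths g 0 u" if "u \<in> {0..1}" for u
    unfolding polygonal_lengths_def mem_Collect_eq F_def
    by (rule exI[of _ n], rule exI[of _ "\<lambda>i. min (t i) u"]) (use t that in \<open>auto simp: min_le_iff_disj\<close>)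
  define H where "H u = (\<Sum>i<n. dist (g (max (t i) u)) (g (max (t (Suc i)) u)))" for u
  have H: "H u \<in> polygonal_lengths g u 1" if "u \<in> {0..1}" for u
    unfolding polygonal_lengths_def mem_Collect_eq H_def
    by (rule exI[of _ n], rule exI[of _ "\<lambda>i. max (t i) u"]) (use t that in \<open>auto simp: le_max_iff_disj\<close>)
  show thesis
  proof
    have "continuous_on {0..1} (\<lambda>u. g (min (t i) u))" if "i \<le> n" for i
      using t0[OF that]
      by (intro continuous_on_compose2[OF cont] continuous_intros) auto
    then show "continuous_on {0..1} F"
      unfolding F_def by (intro continuous_intros) auto
  next
    fix u :: real assume u: "u \<in> {0..1}"
    \<comment> \<open>A partition interval on one side of \<open>u\<close> contributes its full
      chord to one sum and 0 to the other; one containing \<open>u\<close> is split there, by the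
      triangle inequality.\<close>
    have "p \<le> F u + H u"
      unfolding t(1) F_def H_def sum.distrib[symmetric]
    proof (rule sum_mono)
      fix i assume "i \<in> {..<n}"
      then have "t i \<le> t (Suc i)" using t by auto
      then show "dist (g (t i)) (g (t (Suc i)))
          \<le> dist (g (min (t i) u)) (g (min (t (Suc i)) u))
            + dist (g (max (t i) u)) (g (max (t (Suc i)) u))"
        using dist_triangle[of "g (t i)" "g (t (Suc i))" "g u"]
        by (auto simp: min_def max_def)
    qed
    moreover have "F u \<le> curve_length g 0 u" "H u \<le> curve_length g u 1"
      unfolding curve_length_def using F[OF u] H[OF u] u
      by (auto intro!: cSup_upper bdd_above_polygonal_lengths_mono[OF bdd])
    moreover have "curve_length g 0 u + curve_length g u 1 \<le> curve_length g 0 1"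
      using u by (intro curve_length_superadditive bdd) auto
    \<comment> \<open>\<open>F\<close> and \<open>H\<close> underestimate the two partial lengths,
      and their total deficit is below \<open>e\<close>, so the deficit of \<open>F\<close> alone is
      too.\<close>
    ultimately show "\<bar>F u - curve_length g 0 u\<bar> < e"
      using p(2) by linarith
  qed
qed

lemma continuous_on_curve_length:
  assumes "rectifiable_path g"
  shows "continuous_on {0..1} (curve_length g 0)"
proof -
  have "\<exists>F. continuous_on {0..1} F \<and>
      (\<forall>u\<in>{0..1}. \<bar>F u - curve_length g 0 u\<bar> < inverse (real (Suc k)))" for k
    using curve_length_approx[OF assms, of "inverse (real (Suc k))"] by (metis inverse_positive_iff_positive of_nat_0_less_iff zero_less_Suc)
  then obtain F where F: "\<And>k. continuous_on {0..1} (F k)"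
      "\<And>k u. u \<in> {0..1} \<Longrightarrow> \<bar>F k u - curve_length g 0 u\<bar> < inverse (real (Suc k))"
    by metis
  have "uniform_limit {0..1} F (curve_length g 0) sequentially"
  proof (rule uniform_limitI)
    fix e :: real assume "e > 0"
    then have "\<forall>\<^sub>F k in sequentially. inverse (real (Suc k)) < e"
      by (intro order_tendstoD[OF LIMSEQ_inverse_real_of_nat])
    then show "\<forall>\<^sub>F k in sequentially. \<forall>u\<in>{0..1}. dist (F k u) (curve_length g 0 u) < e"
    proof eventually_elim
      case (elim k)
      then show ?case using F(2)[of _ k] unfolding dist_real_def by (meson less_trans)
    qed
  qed
  then show ?thesis
    by (rule uniform_limit_theorem[rotated]) (auto simp: F)
qed

lemma curve_length_nonneg:
  assumes "rectifiable_path g"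
  shows "curve_length g 0 1 \<ge> 0"
proof -
  have "dist (g 0) (g 1) \<le> curve_length g 0 1"
    using assms by (intro dist_le_curve_length) (auto simp: rectifiable_path_def)
  then show ?thesis using zero_le_dist[of "g 0" "g 1"] by linarith
qed

section \<open>Parametrisation by arc length\<close>

lemma arclength_paramE:
  assumes "rectifiable_path g" "s \<in> {0..curve_length g 0 1}"
  obtains t where "t \<in> {0..1}" "curve_length g 0 t = s" "arclength_param g s = g t"
proof -
  \<comment> \<open>The intermediate value theorem for the length function provides the witness that
    the choice operator in \<open>arclength_param\<close> requires.\<close>
  have "\<exists>t\<ge>0. t \<le> 1 \<and> curve_length g 0 t = s"
    using assms by (intro IVT' continuous_on_curve_length) (auto simp: curve_length_refl)
  then have "\<exists>t. t \<in> {0..1} \<and> curve_length g 0 t = s" by auto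
  from someI_ex[OF this] show thesis
    using that unfolding arclength_param_def by blast
qed

text \<open>Whichever parameters are chosen for \<open>s\<close> and \<open>s'\<close>, the chord
  between their images is at most the length between them, so the map is 1-Lipschitz.\<close>

lemma continuous_on_arclength_param:
  assumes "rectifiable_path g"
  shows "continuous_on {0..curve_length g 0 1} (arclength_param g)"
proof -
  have "dist (arclength_param g s) (arclength_param g s') \<le> dist s s'"
    if s: "s \<in> {0..curve_length g 0 1}" "s' \<in> {0..curve_length g 0 1}" for s s'
  proof -
    obtain t where "t \<in> {0..1}" "curve_length g 0 t = s" "arclength_param g s = g t"
      using arclength_paramE[OF assms s(1)] by blast
    moreover obtain t' where "t' \<in> {0..1}" "curve_length g 0 t' = s'" "arclength_param g s' = g t'"
      using arclength_paramE[OF assms s(2)] by blast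
    ultimately show ?thesis
      using dist_le_curve_length_diff[OF assms, of t t'] dist_le_curve_length_diff[OF assms, of t' t]
      by (cases "t \<le> t'") (auto simp: dist_real_def dist_commute)
  qed
  then have "1-lipschitz_on {0..curve_length g 0 1} (arclength_param g)"
    by (intro lipschitz_onI) auto
  then show ?thesis by (rule lipschitz_on_continuous_on)
qed

lemma arclength_param_in_path_image:
  assumes "rectifiable_path g" "s \<in> {0..curve_length g 0 1}"
  shows "arclength_param g s \<in> path_image g"
  using arclength_paramE[OF assms] by (metis imageI path_image_def)

section \<open>The quasihyperbolic metric\<close>

lemma inverse_bdist_integrable:
  fixes G :: "'a::euclidean_space set"
  assumes "open G" "G \<noteq> UNIV" "rectifiable_path g" "path_image g \<subseteq> G"
  shows "(\<lambda>s. 1 / bdist G (arclength_param g s)) integrable_on {0..curve_length g 0 1}"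
proof (rule integrable_continuous_real)
  have "bdist G (arclength_param g s) \<noteq> 0" if "s \<in> {0..curve_length g 0 1}" for s
    using bdist_pos[OF assms(1,2)] arclength_param_in_path_image[OF assms(3) that] assms(4)
    by force
  then show "continuous_on {0..curve_length g 0 1} (\<lambda>s. 1 / bdist G (arclength_param g s))"
    unfolding bdist_def
    by (intro continuous_intros continuous_on_arclength_param assms(3)) auto
qed

text \<open>Without integrability the integral has the default value 0. The bound 0 makes the
  infimum defining \<open>quasihyperbolic\<close> one over a set bounded below.\<close>

lemma arclength_integral_inverse_bdist_nonneg:
  "arclength_integral g (\<lambda>z. 1 / bdist G z) \<ge> 0"
proof -
  have "integral A (\<lambda>s. 1 / bdist G (arclength_param g s)) \<ge> 0" for A
    by (cases "(\<lambda>s. 1 / bdist G (arclength_param g s)) integrable_on A")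
      (auto intro!: integral_nonneg simp: not_integrable_integral bdist_def infdist_nonneg)
  then show ?thesis by (simp add: arclength_integral_def)
qed

section \<open>Rectifiable paths in domains\<close>

lemma lipschitz_imp_rectifiable_path:
  assumes "C-lipschitz_on {0..1} g"
  shows "rectifiable_path g"
proof -
  have "p \<le> C" if p: "p \<in> polygonal_lengths g 0 1" for p
  proof -
    obtain n t where t: "p = (\<Sum>i<n. dist (g (t i)) (g (t (Suc i))))" "t 0 = 0" "t n = 1"
        "\<forall>i<n. t i \<le> t (Suc i)"
      using p by (auto simp: polygonal_lengths_def)
    have "t i \<in> {0..1}" if "i \<le> n" for i
      using partition_mono[of n t 0 i] partition_mono[of n t i n] t that by auto
    then have "p \<le> (\<Sum>i<n. C * (t (Suc i) - t i))"
      unfolding t(1) using t(4)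
      by (intro sum_mono order_trans[OF lipschitz_onD[OF assms]]) (auto simp: dist_real_def)
    also have "\<dots> = C"
      using t by (simp add: sum_distrib_left[symmetric] sum_lessThan_telescope)
    finally show ?thesis .
  qed
  then show ?thesis
    unfolding rectifiable_path_def path_def bdd_above_def
    using lipschitz_on_continuous_on[OF assms] by auto
qed

text \<open>A polynomial path joins the points; its derivative is bounded on the unit interval,
  hence it is Lipschitz. This keeps the infimum in \<open>quasihyperbolic\<close> from ranging over
  the empty set.\<close>

lemma domain_set_rectifiable_path:
  assumes "domain_set G" "x \<in> G" "y \<in> G"
  obtains g where "rectifiable_path g" "path_image g \<subseteq> G" "pathstart g = x" "pathfinish g = y"
proof -
  obtain g where g: "polynomial_function g" "path_image g \<subseteq> G" "pathstart g = x" "pathfinish g = y"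
    using connected_open_polynomial_connected assms unfolding domain_set_def by metis
  obtain g' where g': "polynomial_function g'" "\<And>t. (g has_vector_derivative g' t) (at t)"
    using has_vector_derivative_polynomial_function[OF g(1)] by blast
  have "compact (g' ` {0..1})"
    by (intro compact_continuous_image continuous_on_polymonial_function g'(1)) auto
  then obtain B where B: "B > 0" "\<And>t. t \<in> {0..1} \<Longrightarrow> norm (g' t) \<le> B"
    by (auto dest!: compact_imp_bounded simp: bounded_pos)
  have "B-lipschitz_on {0..1} g"
  proof (rule bounded_derivative_imp_lipschitz)
    show "(g has_derivative (\<lambda>h. h *\<^sub>R g' t)) (at t within {0..1})" for t
      using g'(2) by (simp add: has_vector_derivative_def has_derivative_at_withinI)
    show "onorm (\<lambda>h. h *\<^sub>R g' t) \<le> B" if "t \<in> {0..1}" for t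
      using B(2)[OF that] by (simp add: onorm_scaleR_left onorm_id)
  qed (use B in auto)
  then show thesis
    using that lipschitz_imp_rectifiable_path g by blast
qed

text \<open>Every path admissible in \<open>G\<close> is admissible in \<open>H\<close>, and along
  it the pointwise bound on the densities integrates.\<close>

lemma quasihyperbolic_mult_le:
  fixes G H :: "'a::euclidean_space set"
  assumes G: "domain_set G" "G \<noteq> UNIV" and H: "domain_set H" "H \<noteq> UNIV" and "G \<subseteq> H"
    and "c \<ge> 0" and c: "\<And>z. z \<in> G \<Longrightarrow> c * bdist G z \<le> bdist H z"
    and xy: "x \<in> G" "y \<in> G"
  shows "c * quasihyperbolic H x y \<le> quasihyperbolic G x y"
  unfolding quasihyperbolic_def[of G]
proof (rule cINF_greatest)
  show "{g. rectifiable_path g \<and> path_image g \<subseteq> G \<and> pathstart g = x \<and> pathfinish g = y} \<noteq> {}"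
    using domain_set_rectifiable_path[OF G(1) xy] by blast
next
  fix g assume "g \<in> {g. rectifiable_path g \<and> path_image g \<subseteq> G \<and> pathstart g = x \<and> pathfinish g = y}"
  then have g: "rectifiable_path g" "path_image g \<subseteq> G" "pathstart g = x" "pathfinish g = y"
    by auto
  have open_GH: "open G" "open H"
    using G H by (auto simp: domain_set_def)
  have "quasihyperbolic H x y \<le> arclength_integral g (\<lambda>z. 1 / bdist H z)"
    unfolding quasihyperbolic_def
    by (rule cINF_lower)
      (use g \<open>G \<subseteq> H\<close> in \<open>auto intro!: bdd_belowI2[of _ 0] arclength_integral_inverse_bdist_nonneg\<close>)
  then have "c * quasihyperbolic H x y \<le> c * arclength_integral g (\<lambda>z. 1 / bdist H z)"
    using \<open>c \<ge> 0\<close> by (rule mult_left_mono)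
  also have "\<dots> = integral {0..curve_length g 0 1} (\<lambda>s. c * (1 / bdist H (arclength_param g s)))"
    unfolding arclength_integral_def by (rule integral_mult_right[symmetric])
  also have "\<dots> \<le> arclength_integral g (\<lambda>z. 1 / bdist G z)"
    unfolding arclength_integral_def
  proof (rule integral_le)
    show "(\<lambda>s. c * (1 / bdist H (arclength_param g s))) integrable_on {0..curve_length g 0 1}"
      using g \<open>G \<subseteq> H\<close>
      by (intro integrable_on_mult_right inverse_bdist_integrable open_GH H) auto
    show "(\<lambda>s. 1 / bdist G (arclength_param g s)) integrable_on {0..curve_length g 0 1}"
      using g by (intro inverse_bdist_integrable open_GH G)
    fix s assume "s \<in> {0..curve_length g 0 1}"
    then have z: "arclength_param g s \<in> G"
      using arclength_param_in_path_image g by blast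
    then have "bdist G (arclength_param g s) > 0" "bdist H (arclength_param g s) > 0"
      using open_GH G H \<open>G \<subseteq> H\<close> by (auto intro!: bdist_pos)
    then show "c * (1 / bdist H (arclength_param g s)) \<le> 1 / bdist G (arclength_param g s)"
      using c[OF z] by (simp add: field_simps)
  qed
  finally show "c * quasihyperbolic H x y \<le> arclength_integral g (\<lambda>z. 1 / bdist G z)" .
qed

section \<open>Comparison of both metrics on a bounded subdomain\<close>

theorem theorem4p6:
  fixes G1 G2 :: "(real ^ 'n) set" and c :: real
  assumes "domain_set G1" and "bounded G1"
    and "domain_set G2" and "G2 \<noteq> UNIV"
    and "G1 \<subseteq> G2"
    and "c = 1 + 2 * setdist G1 (frontier G2) / diameter G1"
  shows "\<forall>x\<in>G1. \<forall>y\<in>G1.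
           distance_ratio G1 x y \<ge> c * distance_ratio G2 x y \<and>
           quasihyperbolic G1 x y \<ge> c * quasihyperbolic G2 x y"
proof (intro ballI conjI)
  fix x y assume xy: "x \<in> G1" "y \<in> G1"
  let ?d = "setdist G1 (frontier G2)" and ?D = "diameter G1"
  have G: "open G1" "open G2" "G1 \<noteq> UNIV"
    using assms not_bounded_UNIV by (auto simp: domain_set_def)
  have pos: "bdist G1 z > 0" if "z \<in> G1" for z
    using bdist_pos G that by blast
  have add_le: "bdist G1 z + ?d \<le> bdist G2 z" if "z \<in> G1" for z
    using bdist_add_setdist_le G assms that by blast
  have diam: "dist z w + bdist G1 z + bdist G1 w \<le> ?D" if "z \<in> G1" "w \<in> G1" for z w
    using dist_add_bdist_le_diameter assms that by blast
  show "distance_ratio G1 x y \<ge> c * distance_ratio G2 x y"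
    unfolding distance_ratio_def assms(6)
    \<comment> \<open>The bounds at \<open>x\<close> and \<open>y\<close> pass to the minima: the
      gap \<open>?d\<close> still separates them, and twice the inner minimum is at most the sum of
      the inner boundary distances.\<close>
    using xy pos[of x] pos[of y] add_le[of x] add_le[of y] diam[of x y]
    by (intro ln_ratio_le) (auto simp: min_def)
  have "c * bdist G1 z \<le> bdist G2 z" if "z \<in> G1" for z
  proof -
    have D: "2 * bdist G1 z \<le> ?D" "?D > 0"
      using diam[OF that that] pos[OF that] by auto
    \<comment> \<open>Dividing by \<open>?D > 0\<close> gives
      \<open>(c - 1) * bdist G1 z \<le> ?d\<close>.\<close>
    have "2 * bdist G1 z * ?d \<le> ?D * ?d"
      using D by (intro mult_right_mono) auto
    then have "c * bdist G1 z \<le> bdist G1 z + ?d"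
      unfolding assms(6) using D by (simp add: field_simps)
    then show ?thesis using add_le[OF that] by linarith
  qed
  moreover have "c \<ge> 0"
    unfolding assms(6) using diameter_ge_0[OF assms(2)] by simp
  ultimately show "quasihyperbolic G1 x y \<ge> c * quasihyperbolic G2 x y"
    using assms G xy by (intro quasihyperbolic_mult_le) auto
qed

end
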